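(* Let $\mathbf L=(L,\vee,\wedge)$ be a lattice, $a,b\in L$ with $a\leq b$, $x\in[a,b]$, $y\in L$, and put $e:=(a\vee y)\wedge b$ and $f:=a\vee(y\wedge b)$. Then $f\leq e$, and the following are equivalent: (i) $e,f\in R(a,b,x)$; (ii) $(a\vee y)\wedge x=a$ and $x\vee(y\wedge b)=b$.
   Context: For a lattice $\mathbf L$, elements $a\leq b$ and $x\in[a,b]=\{z\in L\mid a\leq z\leq b\}$, an element $z\in[a,b]$ is a relative complement of $x$ in $[a,b]$ if $x\vee z=b$ and $x\wedge z=a$. $R(a,b,x)$ denotes the set of all relative complements of $x$ in $[a,b]$. *)

theory Defs
  imports Main
begin

text \<open>The side conditions \<open>a \<le> b\<close> and \<open>x \<in> {a..b}\<close> are not built into the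
  definition; they are to be assumed wherever it is used.\<close>

definition rel_complements :: "'a::lattice \<Rightarrow> 'a \<Rightarrow> 'a \<Rightarrow> 'a set" where
  "rel_complements a b x = {z \<in> {a..b}. sup x z = b \<and> inf x z = a}"

end

theory Submission
  imports Defs
begin

text \<open>As \<open>x \<le> b\<close>, the \<open>b\<close> in \<open>e\<close> is absorbed when
  meeting with \<open>x\<close>; dually, as \<open>a \<le> x\<close>, the \<open>a\<close> in
  \<open>f\<close> is absorbed when joining with \<open>x\<close>. So the right-hand side of the
  equivalence is half of the left: the meet equation for \<open>e\<close> and the join equation for
  \<open>f\<close>. The other half follows by monotonicity, since \<open>f \<le> e\<close>.\<close>

theorem theorem1:
  fixes a b x y e f :: "'a::lattice"
  assumes "a \<le> b"
    and "x \<in> {a..b}"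
    and "e = inf (sup a y) b"
    and "f = sup a (inf y b)"
  shows "f \<le> e \<and>
    ((e \<in> rel_complements a b x \<and> f \<in> rel_complements a b x) \<longleftrightarrow>
     (inf (sup a y) x = a \<and> sup x (inf y b) = b))"
proof -
  have x: "a \<le> x" "x \<le> b" using assms(2) by auto
  have fe: "f \<le> e"
    using assms(1) by (auto simp: assms(3,4) intro: le_infI1 le_supI2)
  have bounds: "a \<le> f" "e \<le> b"
    using assms(1) by (auto simp: assms(3,4))
  have inf_e: "inf x e = inf (sup a y) x"
    using x(2) by (simp add: assms(3) inf.absorb2 inf.commute inf.left_commute le_infI1)
  have sup_f: "sup x f = sup x (inf y b)"
    using x(1) by (simp add: assms(4) sup.absorb1 flip: sup.assoc)
  \<comment> \<open>Squeeze: \<open>a \<le> inf x f \<le> inf x e\<close>. The next fact is its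
    dual, from \<open>sup x f \<le> sup x e \<le> b\<close>.\<close>
  have "inf x f = a" if "inf x e = a"
    using inf_mono[OF order_refl fe, of x] that x(1) bounds(1) by (auto intro: antisym)
  moreover have "sup x e = b" if "sup x f = b"
    using sup_mono[OF order_refl fe, of x] that x(2) bounds(2) by (auto intro: antisym)
  ultimately show ?thesis
    using fe bounds order_trans[OF bounds(1) fe] order_trans[OF fe bounds(2)]
    by (auto simp: rel_complements_def inf_e sup_f)
qed

end
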